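(* Let $Z_1,Z_2,\dots$ be a strictly stationary ergodic sequence of real random variables with $\mathbb E[Z_1^2]<\infty$, let $f$ satisfy the smoothness assumption in the context, and let $\rho>0$. Let $\widehat P_n$ be the empirical distribution of $Z_1,\dots,Z_n$ and $s_n^2=\mathbb E_{\widehat P_n}[Z^2]-\mathbb E_{\widehat P_n}[Z]^2$ the sample variance. Then $$\left|\sup_{P\ll\widehat P_n:\,D_f(P\|\widehat P_n)\le\rho/n}\mathbb E_P[Z]-\mathbb E_{\widehat P_n}[Z]-\sqrt{\frac\rho n s_n^2}\right|\le\frac{\varepsilon_n}{\sqrt n},$$ where $\varepsilon_n\to0$ almost surely.
   Context: A sequence $\{Z_i\}$ is called ergodic and stationary if for all bounded (measurable) functions $\phi:\mathbb R^k\to\mathbb R$ and $\psi:\mathbb R^m\to\mathbb R$, $\lim_{n\to\infty}\mathbb E[\phi(Z_t,\dots,Z_{t+k-1})\psi(Z_{t+n},\dots,Z_{t+n+m-1})]=\mathbb E[\phi(Z_1,\dots,Z_k)]\,\mathbb E[\psi(Z_1,\dots,Z_m)]$. Smoothness assumption on $f$: $f:[0,\infty)\to\mathbb R\cup\{+\infty\}$ is lower semicontinuous and convex, three times differentiable in a neighborhood of $1$, with $f(1)=f'(1)=0$ and $f''(1)=2$. For probability measures $P\ll Q$, $D_f(P\|Q)=\int f\!\left(\frac{dP}{dQ}\right)dQ$. *)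

theory Defs
  imports "HOL-Probability.Probability"
begin

(* Extended-valued integral as positive part minus negative part.  The value produced in the
   case "infinity minus infinity" is irrelevant below, where the integrand is non-negative. *)
definition ereal_integral :: "'a measure \<Rightarrow> ('a \<Rightarrow> ereal) \<Rightarrow> ereal" where
  "ereal_integral Q g =
     enn2ereal (\<integral>\<^sup>+ x. e2ennreal (g x) \<partial>Q) - enn2ereal (\<integral>\<^sup>+ x. e2ennreal (- g x) \<partial>Q)"

(* Only meant for P absolutely continuous with respect to Q. *)
definition f_divergence :: "(real \<Rightarrow> ereal) \<Rightarrow> 'a measure \<Rightarrow> 'a measure \<Rightarrow> ereal" where
  "f_divergence f P Q = ereal_integral Q (\<lambda>x. f (enn2real (RN_deriv Q P x)))"

definition f_divergence_ball :: "(real \<Rightarrow> ereal) \<Rightarrow> real \<Rightarrow> 'a measure \<Rightarrow> 'a measure set" where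
  "f_divergence_ball f r Q =
     {P. prob_space P \<and> sets P = sets Q \<and> absolutely_continuous Q P \<and> f_divergence f P Q \<le> ereal r}"

(* A function from [0,\<infinity>) to the reals with +\<infinity> is rendered as a function on all reals whose
   values at negative arguments are never constrained or used. *)
definition lsc_convex :: "(real \<Rightarrow> ereal) \<Rightarrow> bool" where
  "lsc_convex f \<longleftrightarrow>
     (\<forall>x\<ge>0. f x \<noteq> -\<infinity>) \<and>
     (\<forall>x\<ge>0. f x \<le> Liminf (at x within {0..}) f) \<and>
     (\<forall>x\<ge>0. \<forall>y\<ge>0. \<forall>u\<ge>0. \<forall>v\<ge>0. u + v = 1 \<longrightarrow> f (u * x + v * y) \<le> ereal u * f x + ereal v * f y)"

definition smooth_divergence_function :: "(real \<Rightarrow> ereal) \<Rightarrow> bool" where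
  "smooth_divergence_function f \<longleftrightarrow>
     lsc_convex f \<and>
     (\<forall>\<^sub>F x in nhds 1. \<bar>f x\<bar> \<noteq> \<infinity> \<and>
        (\<forall>k<3. (deriv ^^ k) (\<lambda>y. real_of_ereal (f y)) field_differentiable (at x))) \<and>
     f 1 = 0 \<and>
     deriv (\<lambda>y. real_of_ereal (f y)) 1 = 0 \<and>
     (deriv ^^ 2) (\<lambda>y. real_of_ereal (f y)) 1 = 2"

(* Functions on k-dimensional space are functions on the product space over the index set
   {..<k}.  Taking \<psi> = 1 shows that the condition contains strict stationarity; for the rest
   it is the asymptotic-independence form of ergodicity. *)
definition ergodic_stationary :: "'a measure \<Rightarrow> (nat \<Rightarrow> 'a \<Rightarrow> real) \<Rightarrow> bool" where
  "ergodic_stationary M Z \<longleftrightarrow>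
     (\<forall>k\<ge>1. \<forall>m\<ge>1. \<forall>\<phi> \<psi>. \<forall>t\<ge>1.
        \<phi> \<in> borel_measurable (\<Pi>\<^sub>M i\<in>{..<k}. (borel :: real measure)) \<longrightarrow>
        \<psi> \<in> borel_measurable (\<Pi>\<^sub>M i\<in>{..<m}. (borel :: real measure)) \<longrightarrow>
        bounded (\<phi> ` space (\<Pi>\<^sub>M i\<in>{..<k}. (borel :: real measure))) \<longrightarrow>
        bounded (\<psi> ` space (\<Pi>\<^sub>M i\<in>{..<m}. (borel :: real measure))) \<longrightarrow>
        (\<lambda>n. \<integral>\<omega>. \<phi> (\<lambda>i\<in>{..<k}. Z (t + i) \<omega>) * \<psi> (\<lambda>i\<in>{..<m}. Z (t + n + i) \<omega>) \<partial>M)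
          \<longlonglongrightarrow> (\<integral>\<omega>. \<phi> (\<lambda>i\<in>{..<k}. Z (1 + i) \<omega>) \<partial>M)
              * (\<integral>\<omega>. \<psi> (\<lambda>i\<in>{..<m}. Z (1 + i) \<omega>) \<partial>M :: real))"

(* Empirical distribution of the sample z 1, ..., z n, for n \<ge> 1. *)
definition empirical :: "nat \<Rightarrow> (nat \<Rightarrow> real) \<Rightarrow> real measure" where
  "empirical n z = distr (uniform_count_measure {1..n}) borel z"

definition mean :: "real measure \<Rightarrow> real" where
  "mean P = (\<integral>x. x \<partial>P)"

definition sample_variance :: "nat \<Rightarrow> (nat \<Rightarrow> real) \<Rightarrow> real" where
  "sample_variance n z = (\<integral>x. x\<^sup>2 \<partial>empirical n z) - (mean (empirical n z))\<^sup>2"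

end

theory Submission
  imports Defs
begin

text \<open>
  Write a measure in the ball as weights \<open>(1 + h\<^sub>i) / n\<close> on the sample, so that \<open>\<Sum>h\<^sub>i = 0\<close> and
  \<open>\<Sum>f (1 + h\<^sub>i) \<le> \<rho>\<close>. For \<open>\<theta> > 1\<close>, \<open>f (1 + h)\<close> lies between \<open>h\<^sup>2 / \<theta>\<^sup>2\<close> and \<open>\<theta>\<^sup>2 h\<^sup>2\<close>
  near \<open>h = 0\<close> and grows at least linearly beyond, by convexity. Cauchy-Schwarz for the small
  \<open>h\<^sub>i\<close>, and the bound \<open>O(\<rho>)\<close> on the total of the large \<open>\<bar>h\<^sub>i\<bar>\<close>, bound the supremum from above;
  the choice \<open>h\<^sub>i\<close> proportional to \<open>Z\<^sub>i\<close> minus the sample mean bounds it from below. The error,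
  scaled by \<open>\<surd>n\<close>, is at most \<open>\<surd>\<rho> (\<theta> - 1) s\<^sub>n + C\<^sub>\<theta> max \<bar>Z\<^sub>i\<bar> / \<surd>n\<close>, also when \<open>s\<^sub>n\<close> is small.

  Hence it suffices that \<open>s\<^sub>n\<close> is almost surely bounded, which follows from stationarity by
  Garsia's proof of the maximal ergodic inequality, and that \<open>max \<bar>Z\<^sub>i\<bar> / \<surd>n\<close> tends to \<open>0\<close>,
  which is Borel-Cantelli. Convergence of the averages is never needed. Taking for \<open>\<epsilon>\<^sub>n\<close> the
  infimum of the bounds over \<open>\<theta> = 1 + 1/j\<close> makes it measurable.
\<close>

subsection \<open>Local and global bounds for the divergence function\<close>

text \<open>Since f(1) = f'(1) = 0, Taylor's formula at 1 with Lagrange remainder leaves only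
  f''(t)/2 * h^2. Differentiability of f'' at 1 makes f'' continuous there, and f''(1) = 2 lies
  strictly between 2/\<theta>^2 and 2\<theta>^2.\<close>

lemma divergence_function_quadratic:
  assumes f: "smooth_divergence_function f" and \<theta>: "\<theta> > 1"
  shows "\<exists>\<delta>>0. \<delta> < 1 \<and>
    (\<forall>h. \<bar>h\<bar> \<le> \<delta> \<longrightarrow> (\<exists>r. f (1 + h) = ereal r \<and> h\<^sup>2 / \<theta>\<^sup>2 \<le> r \<and> r \<le> \<theta>\<^sup>2 * h\<^sup>2))"
proof -
  define F where "F = (\<lambda>y. real_of_ereal (f y))"
  define D where "D m = (deriv ^^ m) F" for m
  have f1: "f 1 = 0" and D1: "D 1 1 = 0" and D2: "D 2 1 = 2"
    and ev: "\<forall>\<^sub>F x in nhds 1. \<bar>f x\<bar> \<noteq> \<infinity> \<and> (\<forall>k<3. D k field_differentiable (at x))"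
    using f by (simp_all add: smooth_divergence_function_def F_def D_def)
  have th2: "\<theta>\<^sup>2 > 1" using \<theta> by simp
  from eventually_nhds_x_imp_x[OF ev] have "D 2 field_differentiable (at 1)"
    by auto
  then have "isCont (D 2) 1"
    by (rule field_differentiable_imp_continuous_at)
  then have t: "(D 2 \<longlongrightarrow> 2) (nhds 1)"
    using D2 tendsto_at_iff_tendsto_nhds[of "D 2" 1] by (simp add: isCont_def)
  have "2 / \<theta>\<^sup>2 < 2" using th2 by (subst pos_divide_less_eq) auto
  note low = order_tendstoD(1)[OF t this]
  have "\<forall>\<^sub>F x in nhds 1. D 2 x < 2 * \<theta>\<^sup>2"
    using th2 by (intro order_tendstoD(2)[OF t]) simp
  from low this ev
  have "\<forall>\<^sub>F x in nhds 1. 2 / \<theta>\<^sup>2 < D 2 x \<and> D 2 x < 2 * \<theta>\<^sup>2 \<and> \<bar>f x\<bar> \<noteq> \<infinity> \<and>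
      (\<forall>k<3. D k field_differentiable (at x))"
    by eventually_elim blast
  then obtain d where d: "d > 0" and
    d': "\<And>x. dist x 1 < d \<Longrightarrow> 2 / \<theta>\<^sup>2 < D 2 x \<and> D 2 x < 2 * \<theta>\<^sup>2 \<and> \<bar>f x\<bar> \<noteq> \<infinity> \<and>
      (\<forall>k<3. D k field_differentiable (at x))"
    by (auto simp: eventually_nhds_metric)
  \<comment> \<open>Half the radius keeps the closed interval around 1 inside the open ball; the cap
    1/2 gives \<delta> < 1, which later keeps the densities 1 + h positive.\<close>
  define \<delta> where "\<delta> = min (d/2) (1/2)"
  have \<delta>: "\<delta> > 0" "\<delta> < 1" "\<delta> < d" using d by (auto simp: \<delta>_def)
  show ?thesis
  proof (rule exI[of _ \<delta>], safe intro!: \<delta>)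
    fix h assume h: "\<bar>h\<bar> \<le> \<delta>"
    have fin: "\<bar>f (1+h)\<bar> \<noteq> \<infinity>" using d'[of "1+h"] h \<delta> by (simp add: dist_real_def)
    have F: "h\<^sup>2 / \<theta>\<^sup>2 \<le> F (1+h) \<and> F (1+h) \<le> \<theta>\<^sup>2 * h\<^sup>2"
    \<comment> \<open>Taylor's theorem demands a point different from the centre.\<close>
    proof (cases "h = 0")
      case True then show ?thesis using f1 by (simp add: F_def)
    next
      case False
      have der: "\<forall>m t. m < 2 \<and> 1-\<delta> \<le> t \<and> t \<le> 1+\<delta> \<longrightarrow> DERIV (D m) t :> D (Suc m) t"
      proof clarify
        fix m :: nat and t assume "m < 2" "1-\<delta> \<le> t" "t \<le> 1+\<delta>"
        then have "D m field_differentiable (at t)"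
          using d'[of t] \<delta> by (auto simp: dist_real_def)
        then show "DERIV (D m) t :> D (Suc m) t"
          by (simp add: D_def DERIV_deriv_iff_field_differentiable)
      qed
      have "- \<delta> \<le> h" "h \<le> \<delta>" using h by auto
      then have "\<exists>t. (if 1 + h < 1 then 1 + h < t \<and> t < 1 else 1 < t \<and> t < 1 + h) \<and>
          F (1 + h) = (\<Sum>m<2. D m 1 / fact m * h^m) + D 2 t / fact 2 * h\<^sup>2"
        using Taylor[of 2 D F "1-\<delta>" "1+\<delta>" 1 "1+h", OF _ _ der] False \<delta> by (simp add: D_def)
      then obtain t where t: "if 1 + h < 1 then 1 + h < t \<and> t < 1 else 1 < t \<and> t < 1 + h"
        and eq: "F (1 + h) = (\<Sum>m<2. D m 1 / fact m * h^m) + D 2 t / fact 2 * h\<^sup>2"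
        by blast
      have eq': "F (1+h) = D 2 t / 2 * h\<^sup>2"
        using eq D1 f1 by (simp add: numeral_2_eq_2 D_def F_def)
      have "dist t 1 < d" using t h \<delta> by (auto simp: dist_real_def split: if_splits)
      note b = d'[OF this]
      show ?thesis unfolding eq'
        using mult_right_mono[of "1/\<theta>\<^sup>2" "D 2 t/2" "h\<^sup>2"] mult_right_mono[of "D 2 t/2" "\<theta>\<^sup>2" "h\<^sup>2"] b
        by auto
    qed
    from fin have "f (1+h) = ereal (F (1+h))" by (simp add: F_def ereal_real)
    with F show "\<exists>r. f (1 + h) = ereal r \<and> h\<^sup>2 / \<theta>\<^sup>2 \<le> r \<and> r \<le> \<theta>\<^sup>2 * h\<^sup>2" by blast
  qed
qed

text \<open>If x is farther than \<delta> from 1, the segment from 1 to x contains the point 1 + h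
  with |h| = \<delta>, reached with weight l = \<delta>/|x - 1| on x. Convexity and f(1) = 0 give
  f(1 + h) <= l f(x), and dividing the quadratic bound at 1 + h by l yields linear growth.\<close>

lemma lsc_convex_huber_bound:
  assumes f: "lsc_convex f" and f1: "f 1 = 0" and \<delta>: "0 < \<delta>" "\<delta> < 1"
    and q: "\<And>h. \<bar>h\<bar> \<le> \<delta> \<Longrightarrow> ereal (h\<^sup>2 / \<theta>\<^sup>2) \<le> f (1 + h)"
    and x: "x \<ge> 0"
  shows "ereal ((if \<bar>x - 1\<bar> \<le> \<delta> then (x - 1)\<^sup>2 else \<delta> * \<bar>x - 1\<bar>) / \<theta>\<^sup>2) \<le> f x"
proof (cases "\<bar>x - 1\<bar> \<le> \<delta>")
  case True then show ?thesis using q[of "x - 1"] by simp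
next
  case False
  define l where "l = \<delta> / \<bar>x-1\<bar>"
  define h where "h = l * (x - 1)"
  have l: "0 < l" "l < 1" using False \<delta> by (auto simp: l_def)
  have h: "\<bar>h\<bar> = \<delta>" using False \<delta> by (simp add: h_def l_def abs_mult)
  have "f (l * x + (1-l) * 1) \<le> ereal l * f x + ereal (1-l) * f 1"
    using f[unfolded lsc_convex_def, THEN conjunct2, THEN conjunct2,
      rule_format, of x 1 l "1 - l"] x l by simp
  also have "l * x + (1-l) * 1 = 1 + h" by (simp add: h_def algebra_simps)
  finally have "ereal (h\<^sup>2 / \<theta>\<^sup>2) \<le> ereal l * f x" using q[of h] h f1 by (simp add: order_trans)
  also have "h\<^sup>2 = \<delta>\<^sup>2" using h by (metis power2_abs)
  finally have 1: "ereal (\<delta>\<^sup>2 / \<theta>\<^sup>2) \<le> ereal l * f x" .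
  have "\<delta>\<^sup>2 / \<theta>\<^sup>2 = l * (\<delta> * \<bar>x - 1\<bar> / \<theta>\<^sup>2)"
    using False \<delta> by (simp add: l_def power2_eq_square)
  with 1 have "ereal l * ereal (\<delta> * \<bar>x - 1\<bar> / \<theta>\<^sup>2) \<le> ereal l * f x" by simp
  then have "ereal (\<delta> * \<bar>x - 1\<bar> / \<theta>\<^sup>2) \<le> f x"
    using l by (subst (asm) ereal_mult_le_mult_iff) auto
  with False show ?thesis by simp
qed

text \<open>Split h into its small entries u and its large entries v. The cost is then the squared
  2-norm of u plus \<delta> times the 1-norm of v, up to the factor 1/\<theta>^2, so each norm is
  bounded separately. Cauchy-Schwarz pairs u with a, and the bound A on a handles v.\<close>

lemma huber_duality_bound:
  fixes h a :: "'i \<Rightarrow> real"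
  assumes "I \<noteq> {}" and \<delta>: "\<delta> > 0" and \<theta>: "\<theta> > 0"
    and le: "(\<Sum>i\<in>I. (if \<bar>h i\<bar> \<le> \<delta> then (h i)\<^sup>2 else \<delta> * \<bar>h i\<bar>) / \<theta>\<^sup>2) \<le> \<rho>"
    and a: "\<And>i. i \<in> I \<Longrightarrow> \<bar>a i\<bar> \<le> A"
  shows "(\<Sum>i\<in>I. h i * a i) \<le> \<theta> * sqrt \<rho> * sqrt (\<Sum>i\<in>I. (a i)\<^sup>2) + A * (\<rho> * \<theta>\<^sup>2 / \<delta>)"
proof -
  define u where "u i = (if \<bar>h i\<bar> \<le> \<delta> then h i else 0)" for i
  define v where "v i = (if \<bar>h i\<bar> \<le> \<delta> then 0 else h i)" for i
  have "(\<Sum>i\<in>I. (u i)\<^sup>2) + \<delta> * (\<Sum>i\<in>I. \<bar>v i\<bar>) =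
      (\<Sum>i\<in>I. (if \<bar>h i\<bar> \<le> \<delta> then (h i)\<^sup>2 else \<delta> * \<bar>h i\<bar>))"
    unfolding sum_distrib_left sum.distrib[symmetric]
    by (intro sum.cong) (auto simp: u_def v_def)
  also have "\<dots> \<le> \<rho> * \<theta>\<^sup>2"
    using le \<theta> by (simp add: sum_divide_distrib[symmetric] field_simps)
  finally have s: "(\<Sum>i\<in>I. (u i)\<^sup>2) + \<delta> * (\<Sum>i\<in>I. \<bar>v i\<bar>) \<le> \<rho> * \<theta>\<^sup>2" .
  have u0: "(\<Sum>i\<in>I. (u i)\<^sup>2) \<ge> 0" and v0: "(\<Sum>i\<in>I. \<bar>v i\<bar>) \<ge> 0"
    by (auto intro!: sum_nonneg)
  have su: "(\<Sum>i\<in>I. (u i)\<^sup>2) \<le> \<rho> * \<theta>\<^sup>2" using s v0 \<delta> by (smt (verit) mult_nonneg_nonneg)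
  have sv: "(\<Sum>i\<in>I. \<bar>v i\<bar>) \<le> \<rho> * \<theta>\<^sup>2 / \<delta>" using s u0 \<delta> by (simp add: field_simps)
  have "(\<Sum>i\<in>I. h i * a i) = (\<Sum>i\<in>I. u i * a i) + (\<Sum>i\<in>I. v i * a i)"
    unfolding sum.distrib[symmetric] by (intro sum.cong) (auto simp: u_def v_def)
  also have "(\<Sum>i\<in>I. u i * a i) \<le> L2_set u I * L2_set a I"
    by (rule order_trans[OF sum_mono L2_set_mult_ineq]) (auto simp flip: abs_mult)
  also have "L2_set u I \<le> \<theta> * sqrt \<rho>"
    using real_sqrt_le_mono[OF su] \<theta> by (simp add: L2_set_def real_sqrt_mult mult.commute)
  also have "L2_set a I = sqrt (\<Sum>i\<in>I. (a i)\<^sup>2)" by (simp add: L2_set_def)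
  also have "(\<Sum>i\<in>I. v i * a i) \<le> A * (\<Sum>i\<in>I. \<bar>v i\<bar>)"
    unfolding sum_distrib_left
  proof (rule sum_mono)
    fix i assume "i \<in> I"
    have "v i * a i \<le> \<bar>v i\<bar> * \<bar>a i\<bar>" by (simp flip: abs_mult)
    also have "\<dots> \<le> \<bar>v i\<bar> * A" using a[OF \<open>i \<in> I\<close>] by (rule mult_left_mono) simp
    finally show "v i * a i \<le> A * \<bar>v i\<bar>" by (simp add: mult.commute)
  qed
  also have "A * (\<Sum>i\<in>I. \<bar>v i\<bar>) \<le> A * (\<rho> * \<theta>\<^sup>2 / \<delta>)"
  proof (rule mult_left_mono[OF sv])
    from \<open>I \<noteq> {}\<close> obtain i where "i \<in> I" by auto
    from a[OF this] show "A \<ge> 0" by linarith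
  qed
  finally show ?thesis by (simp add: mult_right_mono)
qed

subsection \<open>Divergence balls around empirical distributions\<close>

lemma prob_space_empirical: "n \<ge> 1 \<Longrightarrow> prob_space (empirical n z)"
  unfolding empirical_def
  by (intro prob_space.prob_space_distr prob_space_uniform_count_measure) auto

lemma sets_empirical [measurable_cong, simp]: "sets (empirical n z) = sets borel"
  by (simp add: empirical_def)

lemma AE_empirical_in_sample: "AE x in empirical n z. x \<in> z ` {1..n}"
  unfolding empirical_def
  by (subst AE_distr_iff) (auto intro!: AE_I2 simp: space_uniform_count_measure finite_imp_closed borel_closed)

text \<open>The integrands used below involve \<open>f\<close>, which is arbitrary on negative arguments and hence
  possibly not measurable; on a finite support every integrand agrees with a simple function.\<close>
lemma nn_integral_empirical:
  "(\<integral>\<^sup>+ x. g x \<partial>empirical n z) = (\<Sum>i\<in>{1..n}. g (z i)) / of_nat n"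
proof -
  let ?S = "z ` {1..n}"
  \<comment> \<open>The sum runs over the distinct sample values, not over indices, so that a
    repeated observation is counted once in \<open>g'\<close>.\<close>
  define g' where "g' x = (\<Sum>s\<in>?S. g s * indicator {s} x)" for x
  have g': "g' x = g x" if "x \<in> ?S" for x
  proof -
    have "g' x = (\<Sum>s\<in>?S. if s = x then g s else 0)"
      unfolding g'_def by (intro sum.cong) (auto simp: indicator_def)
    also have "\<dots> = g x" using that by (subst sum.delta) auto
    finally show ?thesis .
  qed
  have [measurable]: "g' \<in> borel_measurable borel" unfolding g'_def by measurable
  have "(\<integral>\<^sup>+ x. g x \<partial>empirical n z) = (\<integral>\<^sup>+ x. g' x \<partial>empirical n z)"
    by (intro nn_integral_cong_AE eventually_mono[OF AE_empirical_in_sample]) (simp add: g')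
  also have "\<dots> = (\<integral>\<^sup>+ i. g' (z i) \<partial>uniform_count_measure {1..n})"
    unfolding empirical_def by (subst nn_integral_distr) auto
  also have "\<dots> = (\<Sum>i\<in>{1..n}. ennreal (1 / n) * g' (z i))"
    unfolding uniform_count_measure_def by (subst nn_integral_point_measure_finite) auto
  also have "\<dots> = (\<Sum>i\<in>{1..n}. ennreal (1 / n) * g (z i))"
    by (intro sum.cong) (auto simp: g')
  also have "\<dots> = (\<Sum>i\<in>{1..n}. g (z i)) / of_nat n"
    unfolding sum_distrib_left[symmetric]
    \<comment> \<open>For n = 0 the sum is empty and 0 / 0 = 0 in the extended nonnegative
      reals.\<close>
    by (cases "n = 0") (simp_all add: divide_ennreal_def inverse_ennreal mult.commute ennreal_of_nat_eq_real_of_nat divide_inverse)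
  finally show ?thesis .
qed

lemma integral_empirical:
  assumes [measurable]: "g \<in> borel_measurable borel"
  shows "(\<integral>x. g x \<partial>empirical n z) = (\<Sum>i\<in>{1..n}. g (z i)) / real n"
  unfolding empirical_def
  by (subst integral_distr) (auto simp: integral_uniform_count_measure)

text \<open>Each sample point carries mass at least 1/n, so no null set contains one. As
  \<open>nn_integral_empirical\<close> holds for every integrand, the argument covers non-measurable
  P.\<close>

lemma AE_empirical_iff:
  assumes "n \<ge> 1"
  shows "(AE x in empirical n z. P x) \<longleftrightarrow> (\<forall>i\<in>{1..n}. P (z i))"
proof
  assume "\<forall>i\<in>{1..n}. P (z i)"
  then show "AE x in empirical n z. P x"
    by (intro eventually_mono[OF AE_empirical_in_sample]) auto
next
  assume "AE x in empirical n z. P x"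
  then have "(\<integral>\<^sup>+ x. indicator {x. \<not> P x} x \<partial>empirical n z) = (\<integral>\<^sup>+ x. 0 \<partial>empirical n z)"
    by (intro nn_integral_cong_AE) (auto elim!: eventually_mono)
  then have "(\<Sum>i\<in>{1..n}. indicator {x. \<not> P x} (z i) :: ennreal) = 0"
    using assms by (simp add: nn_integral_empirical ennreal_divide_eq_0_iff)
  then show "\<forall>i\<in>{1..n}. P (z i)"
    by (auto simp: indicator_def split: if_splits)
qed

text \<open>The Radon-Nikodym derivative is determined only almost everywhere, but for an empirical
  measure this fixes its values at the sample points. Nonnegativity of f removes the negative part
  of \<open>ereal_integral\<close>.\<close>

lemma f_divergence_density_empirical:
  assumes n: "n \<ge> 1" and [measurable]: "d \<in> borel_measurable borel"
    and d: "\<And>i. i \<in> {1..n} \<Longrightarrow> 0 \<le> d (z i)" and f: "\<And>x. 0 \<le> x \<Longrightarrow> 0 \<le> f x"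
  shows "f_divergence f (density (empirical n z) (\<lambda>x. ennreal (d x))) (empirical n z) =
    enn2ereal ((\<Sum>i\<in>{1..n}. e2ennreal (f (d (z i)))) / of_nat n)"
proof -
  interpret Q: prob_space "empirical n z" using n by (rule prob_space_empirical)
  let ?D = "RN_deriv (empirical n z) (density (empirical n z) (\<lambda>x. ennreal (d x)))"
  have "AE x in empirical n z. ennreal (d x) = ?D x"
    by (rule Q.RN_deriv_unique) auto
  then have D: "?D (z i) = ennreal (d (z i))" if "i \<in> {1..n}" for i
    using n that by (simp add: AE_empirical_iff)
  have "e2ennreal (f (enn2real (?D (z i)))) = e2ennreal (f (d (z i)))"
    "e2ennreal (- f (enn2real (?D (z i)))) = 0" if "i \<in> {1..n}" for i
    using d[OF that] f[OF d[OF that]] by (auto simp: D[OF that] e2ennreal_neg)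
  then show ?thesis
    by (simp add: f_divergence_def ereal_integral_def nn_integral_empirical zero_ennreal.rep_eq)
qed

lemma mean_density_empirical:
  assumes n: "n \<ge> 1" and [measurable]: "d \<in> borel_measurable borel"
    and d: "\<And>i. i \<in> {1..n} \<Longrightarrow> 0 \<le> d (z i)"
  shows "mean (density (empirical n z) (\<lambda>x. ennreal (d x))) = (\<Sum>i\<in>{1..n}. d (z i) * z i) / n"
proof -
  have "AE x in empirical n z. 0 \<le> d x" using n d by (simp add: AE_empirical_iff)
  then show ?thesis unfolding mean_def
    by (subst integral_density) (auto simp: integral_empirical)
qed

lemma emeasure_density_empirical_UNIV:
  assumes n: "n \<ge> 1" and [measurable]: "d \<in> borel_measurable borel"
  shows "emeasure (density (empirical n z) d) UNIV = (\<Sum>i\<in>{1..n}. d (z i)) / of_nat n"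
proof -
  have "emeasure (density (empirical n z) d) UNIV = (\<integral>\<^sup>+x. d x * indicator UNIV x \<partial>empirical n z)"
    by (rule emeasure_density) auto
  then show ?thesis by (simp add: nn_integral_empirical)
qed

text \<open>Used for the upper bound on the supremum. Replacing f by a real minorant L turns the
  divergence constraint into an inequality between real numbers, although f may take the value
  +\<infinity>.\<close>

lemma f_divergence_ball_empirical_elim:
  assumes n: "n \<ge> 1" and f: "\<And>x. 0 \<le> x \<Longrightarrow> 0 \<le> f x"
    and P: "P \<in> f_divergence_ball f (\<rho> / n) (empirical n z)" and \<rho>: "\<rho> > 0"
    and L: "\<And>x. 0 \<le> x \<Longrightarrow> ereal (L x) \<le> f x" "\<And>x. 0 \<le> L x"
  obtains d where "\<And>i. i \<in> {1..n} \<Longrightarrow> 0 \<le> d (z i)" "(\<Sum>i\<in>{1..n}. d (z i)) = n"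
    "mean P = (\<Sum>i\<in>{1..n}. d (z i) * z i) / n" "(\<Sum>i\<in>{1..n}. L (d (z i))) \<le> \<rho>"
proof -
  let ?Q = "empirical n z"
  interpret Q: prob_space ?Q using n by (rule prob_space_empirical)
  from P have "prob_space P" and sets: "sets P = sets ?Q" and ac: "absolutely_continuous ?Q P"
    and div: "f_divergence f P ?Q \<le> ereal (\<rho> / n)"
    by (auto simp: f_divergence_ball_def)
  interpret P: prob_space P by fact
  have sp: "space P = UNIV" using sets_eq_imp_space_eq[OF sets] by (simp add: empirical_def)
  define D where "D = RN_deriv ?Q P"
  have [measurable]: "D \<in> borel_measurable borel"
    using borel_measurable_RN_deriv[of ?Q P] by (simp add: D_def)
  have PD: "density ?Q D = P" unfolding D_def by (rule Q.density_RN_deriv) fact+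
  define d where "d x = enn2real (D x)" for x
  have [measurable]: "d \<in> borel_measurable borel" unfolding d_def by measurable
  have "(\<Sum>i\<in>{1..n}. D (z i)) / of_nat n = 1"
    using emeasure_density_empirical_UNIV[OF n, of D z] P.emeasure_space_1 by (simp add: PD sp)
  then have sD: "(\<Sum>i\<in>{1..n}. D (z i)) = of_nat n"
    using n by (metis divide_eq_1_ennreal ennreal_top_neq_zero)
  \<comment> \<open>A finite total excludes infinite values of D on the sample, so
    \<open>enn2real\<close> loses nothing there.\<close>
  then have "(\<Sum>i\<in>{1..n}. D (z i)) \<noteq> \<top>" by simp
  then have Dd: "D (z i) = ennreal (d (z i))" if "i \<in> {1..n}" for i
    using that by (auto simp: d_def less_top)
  have "AE x in ?Q. D x = ennreal (d x)" using n Dd by (simp add: AE_empirical_iff)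
  then have Pd: "P = density ?Q (\<lambda>x. ennreal (d x))"
    unfolding PD[symmetric] by (intro density_cong) auto
  have d0: "0 \<le> d x" for x by (simp add: d_def)
  have "ennreal (\<Sum>i\<in>{1..n}. d (z i)) = ennreal n"
    using sD Dd d0 by (simp add: ennreal_of_nat_eq_real_of_nat flip: sum_ennreal)
  then have sd: "(\<Sum>i\<in>{1..n}. d (z i)) = n"
    by (subst (asm) ennreal_inj) (auto intro!: sum_nonneg d0)
  have "ennreal (\<Sum>i\<in>{1..n}. L (d (z i))) = (\<Sum>i\<in>{1..n}. e2ennreal (ereal (L (d (z i)))))"
    using L(2) by simp
  also have "\<dots> \<le> (\<Sum>i\<in>{1..n}. e2ennreal (f (d (z i))))"
    by (intro sum_mono e2ennreal_mono L d0)
  finally have "ennreal (\<Sum>i\<in>{1..n}. L (d (z i))) / of_nat n \<le> (\<Sum>i\<in>{1..n}. e2ennreal (f (d (z i)))) / of_nat n"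
    by (rule divide_right_mono_ennreal)
  then have "enn2ereal (ennreal (\<Sum>i\<in>{1..n}. L (d (z i))) / of_nat n) \<le> ereal (\<rho> / n)"
    using div f_divergence_density_empirical[of n d z f] n d0 f
    unfolding Pd by (simp add: less_eq_ennreal.rep_eq)
  also have "ennreal (\<Sum>i\<in>{1..n}. L (d (z i))) / of_nat n = ennreal ((\<Sum>i\<in>{1..n}. L (d (z i))) / n)"
    using n by (simp add: ennreal_of_nat_eq_real_of_nat divide_ennreal sum_nonneg L(2))
  finally have "(\<Sum>i\<in>{1..n}. L (d (z i))) \<le> \<rho>"
    using n by (simp add: sum_nonneg L(2) divide_le_cancel)
  moreover have "mean P = (\<Sum>i\<in>{1..n}. d (z i) * z i) / n"
    unfolding Pd by (intro mean_density_empirical n d0) simp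
  ultimately show thesis using that d0 sd by blast
qed

text \<open>Used for the lower bound on the supremum: the quadratic majorant of f near 1 enters as
  U, and fitting it into the budget \<rho> certifies a competitor.\<close>

lemma f_divergence_ball_empirical_intro:
  assumes n: "n \<ge> 1" and f: "\<And>x. 0 \<le> x \<Longrightarrow> 0 \<le> f x"
    and [measurable]: "d \<in> borel_measurable borel"
    and d0: "\<And>i. i \<in> {1..n} \<Longrightarrow> 0 \<le> d (z i)" and sd: "(\<Sum>i\<in>{1..n}. d (z i)) = n"
    and U: "\<And>i. i \<in> {1..n} \<Longrightarrow> f (d (z i)) \<le> ereal (U i)" "(\<Sum>i\<in>{1..n}. U i) \<le> \<rho>"
  shows "density (empirical n z) (\<lambda>x. ennreal (d x)) \<in> f_divergence_ball f (\<rho> / n) (empirical n z)"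
    (is "?P \<in> _")
proof -
  have U0: "0 \<le> U i" if "i \<in> {1..n}" for i
    using U(1)[OF that] f[OF d0[OF that]] by (metis ereal_less_eq(5) order_trans)
  have "emeasure ?P UNIV = (\<Sum>i\<in>{1..n}. ennreal (d (z i))) / of_nat n"
    by (intro emeasure_density_empirical_UNIV n) simp
  also have "\<dots> = 1"
  proof -
    have "(\<Sum>i\<in>{1..n}. ennreal (d (z i))) = ennreal n"
      using d0 by (subst sum_ennreal) (auto simp: sd[simplified])
    then show ?thesis using n by (simp add: ennreal_of_nat_eq_real_of_nat divide_ennreal)
  qed
  finally have "prob_space ?P" by (intro prob_spaceI) (simp add: empirical_def)
  moreover have "absolutely_continuous (empirical n z) ?P"
    by (intro absolutely_continuousI_density) simp
  moreover have "f_divergence f ?P (empirical n z) \<le> ereal (\<rho> / n)"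
  proof -
    have "(\<Sum>i\<in>{1..n}. e2ennreal (f (d (z i)))) \<le> (\<Sum>i\<in>{1..n}. ennreal (U i))"
      using U(1) by (intro sum_mono) (metis e2ennreal_mono e2ennreal_ereal)
    also have "\<dots> = ennreal (\<Sum>i\<in>{1..n}. U i)" by (rule sum_ennreal) (rule U0)
    also have "\<dots> \<le> ennreal \<rho>" using U(2) by (rule ennreal_leI)
    finally have "(\<Sum>i\<in>{1..n}. e2ennreal (f (d (z i)))) / of_nat n \<le> ennreal \<rho> / of_nat n"
      by (rule divide_right_mono_ennreal)
    also have "\<dots> = ennreal (\<rho> / n)"
    proof -
      have "\<rho> \<ge> 0" using U(2) U0 sum_nonneg[of "{1..n}" U] by fastforce
      then show ?thesis using n by (simp add: ennreal_of_nat_eq_real_of_nat divide_ennreal)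
    qed
    finally have "enn2ereal ((\<Sum>i\<in>{1..n}. e2ennreal (f (d (z i)))) / of_nat n) \<le> enn2ereal (ennreal (\<rho> / n))"
      by (simp add: less_eq_ennreal.rep_eq)
    moreover have "\<rho> \<ge> 0" using U(2) U0 sum_nonneg[of "{1..n}" U] by fastforce
    ultimately show ?thesis
      using f_divergence_density_empirical[of n d z f] n d0 f by simp
  qed
  ultimately show ?thesis by (simp add: f_divergence_ball_def)
qed

subsection \<open>The supremum for a deterministic sample\<close>

text \<open>C depends on f, \<rho> and \<theta> but not on n or on the sample, so the bound can be
  applied path by path. The term with \<theta> - 1 is made small by the choice of \<theta>, the
  other one by letting n grow.\<close>

lemma robust_mean_expansion:
  assumes f: "smooth_divergence_function f" and \<rho>: "\<rho> > 0" and \<theta>: "\<theta> > 1"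
  shows "\<exists>C\<ge>0. \<forall>n\<ge>1. \<forall>z m. (\<forall>i\<in>{1..n}. \<bar>z i\<bar> \<le> m) \<longrightarrow>
    \<bar>(SUP P\<in>f_divergence_ball f (\<rho> / real n) (empirical n z). mean P)
      - mean (empirical n z) - sqrt (\<rho> / real n * sample_variance n z)\<bar>
    \<le> (sqrt \<rho> * (\<theta> - 1) * sqrt (sample_variance n z) + C * (m / sqrt (real n))) / sqrt (real n)"
proof -
  obtain \<delta> where \<delta>: "\<delta> > 0" "\<delta> < 1" and
    q: "\<And>h. \<bar>h\<bar> \<le> \<delta> \<Longrightarrow> \<exists>r. f (1 + h) = ereal r \<and> h\<^sup>2 / \<theta>\<^sup>2 \<le> r \<and> r \<le> \<theta>\<^sup>2 * h\<^sup>2"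
    using divergence_function_quadratic[OF f \<theta>] by blast
  define L where "L x = (if \<bar>x - 1\<bar> \<le> \<delta> then (x - 1)\<^sup>2 else \<delta> * \<bar>x - 1\<bar>) / \<theta>\<^sup>2" for x
  have L0: "0 \<le> L x" for x using \<delta> by (simp add: L_def)
  have cf: "lsc_convex f" "f 1 = 0" using f by (auto simp: smooth_divergence_function_def)
  have q1: "ereal (h\<^sup>2 / \<theta>\<^sup>2) \<le> f (1 + h)" if "\<bar>h\<bar> \<le> \<delta>" for h using q[OF that] by auto
  have Lf: "ereal (L x) \<le> f x" if "0 \<le> x" for x
    unfolding L_def by (rule lsc_convex_huber_bound[OF cf \<delta> q1 that])
  have f0: "0 \<le> f x" if "0 \<le> x" for x
    using order_trans[of 0 "ereal (L x)" "f x"] Lf[OF that] L0 by simp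
  \<comment> \<open>This is the bound 2m on the centred sample times the bound
    \<rho>\<theta>^2/\<delta> on the large deviations, without m. It also exceeds 2\<rho>/\<delta>,
    as the case of small variance requires.\<close>
  define C where "C = 2 * \<rho> * \<theta>\<^sup>2 / \<delta>"
  have C0: "C \<ge> 0" using \<rho> \<delta> by (simp add: C_def)
  show ?thesis
  proof (intro exI[of _ C] conjI C0 allI impI)
    fix n :: nat and z :: "nat \<Rightarrow> real" and m :: real
    assume n: "n \<ge> 1" and m: "\<forall>i\<in>{1..n}. \<bar>z i\<bar> \<le> m"
    let ?B = "f_divergence_ball f (\<rho> / real n) (empirical n z)"
    define \<mu> where "\<mu> = (\<Sum>i\<in>{1..n}. z i) / n"
    define a where "a i = z i - \<mu>" for i
    define v where "v = sample_variance n z"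
    have \<mu>: "mean (empirical n z) = \<mu>" by (simp add: mean_def integral_empirical \<mu>_def)
    have sz: "(\<Sum>i\<in>{1..n}. z i) = n * \<mu>" using n by (simp add: \<mu>_def)
    have sa: "(\<Sum>i\<in>{1..n}. a i) = 0" using sz by (simp add: a_def sum_subtractf)
    have saa: "(\<Sum>i\<in>{1..n}. (a i)\<^sup>2) = n * v"
    proof -
      have "(\<Sum>i\<in>{1..n}. (a i)\<^sup>2) = (\<Sum>i\<in>{1..n}. (z i)\<^sup>2) - 2 * \<mu> * (\<Sum>i\<in>{1..n}. z i) + n * \<mu>\<^sup>2"
        by (simp add: a_def power2_diff sum_subtractf sum.distrib sum_distrib_left algebra_simps)
      also have "\<dots> = n * v" unfolding v_def sample_variance_def \<mu>
        using n by (simp add: integral_empirical sz[simplified] field_simps power2_eq_square)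
      finally show ?thesis .
    qed
    have v0: "v \<ge> 0"
    proof -
      have "0 \<le> real n * v" unfolding saa[symmetric] by (intro sum_nonneg) simp
      then show ?thesis using n by (simp add: zero_le_mult_iff)
    qed
    have m0: "0 \<le> m" using m n by (metis abs_ge_zero atLeastAtMost_iff order_refl order_trans)
    have "\<bar>\<Sum>i\<in>{1..n}. z i\<bar> \<le> (\<Sum>i\<in>{1..n}. m)"
      using m by (intro order_trans[OF sum_abs] sum_mono) auto
    then have \<mu>m: "\<bar>\<mu>\<bar> \<le> m" using n by (simp add: \<mu>_def field_simps)
    have am: "\<bar>a i\<bar> \<le> 2 * m" if "i \<in> {1..n}" for i
      using m[rule_format, OF that] \<mu>m by (auto simp: a_def)
    define U where "U = (sqrt \<rho> * \<theta> * sqrt v + C * (m / sqrt n)) / sqrt n"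
    have upper: "mean P - \<mu> \<le> U" if P: "P \<in> ?B" for P
    proof -
      obtain d where sd: "(\<Sum>i\<in>{1..n}. d (z i)) = real n"
        and mP: "mean P = (\<Sum>i\<in>{1..n}. d (z i) * z i) / n"
        and Ld: "(\<Sum>i\<in>{1..n}. L (d (z i))) \<le> \<rho>"
        by (rule f_divergence_ball_empirical_elim[OF n f0 P \<rho> Lf L0])
      \<comment> \<open>The deviations d - 1 sum to zero, so the sample may be centred.\<close>
      have "n * (mean P - \<mu>) = (\<Sum>i\<in>{1..n}. (d (z i) - 1) * a i)"
      proof -
        have "(\<Sum>i\<in>{1..n}. (d (z i) - 1) * a i) = (\<Sum>i\<in>{1..n}. d (z i) * z i) - \<mu> * (\<Sum>i\<in>{1..n}. d (z i)) - (\<Sum>i\<in>{1..n}. a i)"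
          unfolding sum_distrib_left sum_subtractf[symmetric]
          by (intro sum.cong) (auto simp: a_def algebra_simps)
        also have "\<dots> = n * (mean P - \<mu>)"
          using n unfolding sa sd mP by (simp add: field_simps)
        finally show ?thesis by simp
      qed
      also have "\<dots> \<le> \<theta> * sqrt \<rho> * sqrt (\<Sum>i\<in>{1..n}. (a i)\<^sup>2) + 2 * m * (\<rho> * \<theta>\<^sup>2 / \<delta>)"
        by (rule huber_duality_bound[OF _ _ _ Ld[unfolded L_def] am]) (use n \<delta> \<theta> in auto)
      also have "\<dots> = n * U"
      proof -
        define r where "r = sqrt n"
        have r: "r > 0" "real n = r * r" using n by (auto simp: r_def)
        have "sqrt (\<Sum>i\<in>{1..n}. (a i)\<^sup>2) = r * sqrt v"
          unfolding saa by (simp add: real_sqrt_mult r_def)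
        then show ?thesis using r(1) \<delta>
          unfolding U_def C_def r_def[symmetric] unfolding r(2) by (simp add: field_simps)
      qed
      finally show ?thesis using n by simp
    qed
    \<comment> \<open>The supremum is taken in the reals, so a member of the ball bounds it from
      below only once the means are known to be bounded above.\<close>
    then have bdd: "bdd_above (mean ` ?B)"
      by (intro bdd_aboveI[of _ "U + \<mu>"]) (auto simp: algebra_simps)
    \<comment> \<open>Tilting the weights to (1 + t a_i)/n shifts the mean by t v. All deviations
      stay in the quadratic regime, where the total cost is at most \<theta>^2 t^2 n v.\<close>
    have member: "\<exists>P\<in>?B. mean P = \<mu> + t * v"
      if t: "\<And>i. i \<in> {1..n} \<Longrightarrow> \<bar>t * a i\<bar> \<le> \<delta>" and tv: "\<theta>\<^sup>2 * t\<^sup>2 * (n * v) \<le> \<rho>" for t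
    proof -
      define d where "d x = 1 + t * (x - \<mu>)" for x
      have dz: "d (z i) = 1 + t * a i" for i by (simp add: d_def a_def)
      have dm: "d \<in> borel_measurable borel" unfolding d_def by measurable
      have d0: "0 \<le> d (z i)" if "i \<in> {1..n}" for i
        using t[OF that] \<delta> unfolding dz by auto
      have sd: "(\<Sum>i\<in>{1..n}. d (z i)) = n"
        using sa by (simp add: dz sum.distrib flip: sum_distrib_left)
      have "density (empirical n z) (\<lambda>x. ennreal (d x)) \<in> ?B"
      proof (rule f_divergence_ball_empirical_intro[where d = d and U = "\<lambda>i. \<theta>\<^sup>2 * (t * a i)\<^sup>2"])
        show "f (d (z i)) \<le> ereal (\<theta>\<^sup>2 * (t * a i)\<^sup>2)" if "i \<in> {1..n}" for i
          using q[OF t[OF that]] by (auto simp: dz)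
        have "(\<Sum>i\<in>{1..n}. \<theta>\<^sup>2 * (t * a i)\<^sup>2) = \<theta>\<^sup>2 * t\<^sup>2 * (\<Sum>i\<in>{1..n}. (a i)\<^sup>2)"
          by (simp add: sum_distrib_left power_mult_distrib mult.assoc)
        also have "\<dots> \<le> \<rho>" using tv unfolding saa .
        finally show "(\<Sum>i\<in>{1..n}. \<theta>\<^sup>2 * (t * a i)\<^sup>2) \<le> \<rho>" .
      qed (use n f0 dm d0 sd in auto)
      moreover have "mean (density (empirical n z) (\<lambda>x. ennreal (d x))) = \<mu> + t * v"
      proof -
        have "(\<Sum>i\<in>{1..n}. d (z i) * z i) = (\<Sum>i\<in>{1..n}. z i) + t * (\<Sum>i\<in>{1..n}. (a i)\<^sup>2) + t * \<mu> * (\<Sum>i\<in>{1..n}. a i)"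
          unfolding dz sum_distrib_left sum.distrib[symmetric]
          by (intro sum.cong) (auto simp: a_def power2_eq_square algebra_simps)
        also have "\<dots> = n * (\<mu> + t * v)" using sz sa saa by (simp add: algebra_simps)
        finally show ?thesis using n mean_density_empirical[of n d z, OF n dm d0] by simp
      qed
      ultimately show ?thesis by blast
    qed
    let ?S = "SUP P\<in>?B. mean P"
    have lower: "t * v \<le> ?S - \<mu>"
      if t: "\<And>i. i \<in> {1..n} \<Longrightarrow> \<bar>t * a i\<bar> \<le> \<delta>" and tv: "\<theta>\<^sup>2 * t\<^sup>2 * (n * v) \<le> \<rho>" for t
    proof -
      obtain P where P: "P \<in> ?B" "mean P = \<mu> + t * v" using member[OF t tv] by blast
      show ?thesis using cSUP_upper[OF P(1) bdd] P(2) by simp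
    qed
    \<comment> \<open>The tilt t = 0 is the empirical distribution itself.\<close>
    have "?B \<noteq> {}" using member[of 0] \<delta> \<rho> by auto
    then have "?S \<le> U + \<mu>"
      by (intro cSUP_least) (use upper in \<open>auto simp: algebra_simps\<close>)
    then have up: "?S - \<mu> \<le> U" by simp
    define E where "E = (sqrt \<rho> * (\<theta> - 1) * sqrt v + C * (m / sqrt n)) / sqrt n"
    have sq: "sqrt (\<rho> / n * v) = sqrt \<rho> * sqrt v / sqrt n"
      by (simp add: real_sqrt_mult real_sqrt_divide)
    have 1: "?S - \<mu> - sqrt (\<rho> / n * v) \<le> E"
    proof -
    have "U = E + sqrt \<rho> * sqrt v / sqrt n"
      unfolding U_def E_def add_divide_distrib[symmetric] by (simp add: algebra_simps)
    then show ?thesis using up unfolding sq by simp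
  qed
    have 2: "sqrt (\<rho> / n * v) - (?S - \<mu>) \<le> E"
    proof -
      \<comment> \<open>For v > 0 this tilt uses up the budget exactly: \<theta>^2 t^2 n v =
        \<rho>.\<close>
      define t where "t = sqrt \<rho> / (\<theta> * sqrt n * sqrt v)"
      have sn: "sqrt n > 0" using n by simp
      show ?thesis
      proof (cases "v > 0 \<and> t * (2 * m) \<le> \<delta>")
        case True
        then have v: "v > 0" and t: "t * (2 * m) \<le> \<delta>" by auto
        have t0: "t \<ge> 0" using \<rho> \<theta> v0 by (simp add: t_def)
        have "t * v \<le> ?S - \<mu>"
        proof (rule lower)
          fix i assume "i \<in> {1..n}"
          from am[OF this] have "t * \<bar>a i\<bar> \<le> t * (2 * m)" using t0 by (rule mult_left_mono)
          then show "\<bar>t * a i\<bar> \<le> \<delta>" using t t0 by (simp add: abs_mult)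
        next
          have "t\<^sup>2 = \<rho> / (\<theta>\<^sup>2 * n * v)"
            using \<rho> v0 by (simp add: t_def power_divide power_mult_distrib)
          then show "\<theta>\<^sup>2 * t\<^sup>2 * (n * v) \<le> \<rho>" using \<theta> n v by simp
        qed
        moreover have "t * v = sqrt \<rho> * sqrt v / sqrt n / \<theta>"
        proof -
          have "t * v = sqrt \<rho> / (\<theta> * sqrt n) * (v / sqrt v)" by (simp add: t_def)
          also have "\<dots> = sqrt \<rho> * sqrt v / sqrt n / \<theta>"
            using v0 unfolding real_div_sqrt[OF v0] by simp
          finally show ?thesis .
        qed
        ultimately have "sqrt (\<rho> / n * v) - (?S - \<mu>) \<le> sqrt \<rho> * sqrt v / sqrt n * (1 - 1 / \<theta>)"
          unfolding sq right_diff_distrib by simp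
        \<comment> \<open>The relative loss 1 - 1/\<theta> is weakened to \<theta> - 1, so that both
          directions share the error E.\<close>
        also have "\<dots> \<le> sqrt \<rho> * sqrt v / sqrt n * (\<theta> - 1)"
        proof (rule mult_left_mono)
          have "0 \<le> (\<theta> - 1)\<^sup>2 / \<theta>" using \<theta> by simp
          also have "(\<theta> - 1)\<^sup>2 / \<theta> = (\<theta> - 1) - (1 - 1 / \<theta>)"
            using \<theta> by (simp add: power2_eq_square field_simps)
          finally show "1 - 1 / \<theta> \<le> \<theta> - 1" by simp
        qed (use \<rho> v0 in simp)
        also have "\<dots> \<le> E"
          unfolding E_def using C0 m0 sn by (simp add: field_simps)
        finally show ?thesis .
      next
        \<comment> \<open>Either v = 0, or the full tilt leaves the quadratic regime, which happens
          only if sqrt v is of order m / sqrt n. The main term is then itself within the error, and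
          t = 0 suffices.\<close>
        case False
        have "0 * v \<le> ?S - \<mu>" using \<delta> \<rho> by (intro lower) auto
        moreover have "sqrt \<rho> * sqrt v \<le> C * (m / sqrt n)"
        proof (cases "v > 0")
          case v: True
          with False have "\<delta> \<le> t * (2 * m)" by simp
          also have "\<dots> = sqrt \<rho> * 2 * (m / sqrt n) / \<theta> / sqrt v"
            by (simp add: t_def mult_ac)
          finally have "\<delta> * sqrt v \<le> sqrt \<rho> * 2 * (m / sqrt n) / \<theta>"
            using v by (subst (asm) pos_le_divide_eq) auto
          also have "\<dots> \<le> sqrt \<rho> * 2 * (m / sqrt n) / 1"
            using \<theta> \<rho> m0 by (intro divide_left_mono) auto
          finally have "sqrt \<rho> * (\<delta> * sqrt v) \<le> sqrt \<rho> * (sqrt \<rho> * 2 * (m / sqrt n))"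
            using \<rho> by (intro mult_left_mono) auto
          also have "\<dots> = 2 * \<rho> * (m / sqrt n)"
            using \<rho> by (simp flip: mult.assoc)
          finally have "sqrt \<rho> * sqrt v \<le> 2 * \<rho> * (m / sqrt n) / \<delta>"
            using \<delta> by (subst pos_le_divide_eq) (simp_all only: mult_ac)
          also have "\<dots> = 2 * \<rho> / \<delta> * (m / sqrt n)" by simp
          finally have "sqrt \<rho> * sqrt v \<le> 2 * \<rho> / \<delta> * (m / sqrt n)" .
          also have "\<dots> \<le> C * (m / sqrt n)"
          proof (rule mult_right_mono)
            have "1 \<le> \<theta>\<^sup>2" using \<theta> by simp
            then show "2 * \<rho> / \<delta> \<le> C"
              using mult_left_mono[of 1 "\<theta>\<^sup>2" "2 * \<rho> / \<delta>"] \<rho> \<delta> by (simp add: C_def)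
          qed (use m0 in simp)
          finally show ?thesis .
        qed (use C0 m0 v0 in \<open>simp\<close>)
        then have "sqrt \<rho> * sqrt v \<le> sqrt \<rho> * (\<theta> - 1) * sqrt v + C * (m / sqrt n)"
          using \<rho> \<theta> v0 by (smt (verit) mult_nonneg_nonneg real_sqrt_ge_zero)
        then have "sqrt (\<rho> / n * v) \<le> E"
          unfolding sq E_def using sn by (simp add: divide_right_mono)
        ultimately show ?thesis by simp
      qed
    qed
    from 1 2 show "\<bar>?S - mean (empirical n z) - sqrt (\<rho> / real n * sample_variance n z)\<bar>
        \<le> (sqrt \<rho> * (\<theta> - 1) * sqrt (sample_variance n z) + C * (m / sqrt n)) / sqrt n"
      unfolding \<mu> v_def[symmetric] E_def[symmetric] by linarith
  qed
qed

subsection \<open>Consequences of stationarity\<close>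

text \<open>With \<phi> the indicator of A and \<psi> = 1, the sequence in the definition of
  \<open>ergodic_stationary\<close> is constant in n, so its limit statement is an equality of
  probabilities.\<close>

lemma ergodic_stationary_distr:
  assumes "prob_space M" and Z: "\<And>i. i \<ge> 1 \<Longrightarrow> Z i \<in> borel_measurable M"
    and erg: "ergodic_stationary M Z" and k: "k \<ge> 1" and t: "t \<ge> 1"
  shows "distr M (\<Pi>\<^sub>M i\<in>{..<k}. borel) (\<lambda>\<omega>. \<lambda>i\<in>{..<k}. Z (t + i) \<omega>) =
    distr M (\<Pi>\<^sub>M i\<in>{..<k}. borel) (\<lambda>\<omega>. \<lambda>i\<in>{..<k}. Z (1 + i) \<omega>)"
    (is "distr M ?N (?X t) = distr M ?N (?X 1)")
proof (rule measure_eqI)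
  interpret prob_space M by fact
  have X [measurable]: "?X s \<in> measurable M ?N" if "s \<ge> 1" for s
    using that by (intro measurable_restrict Z) auto
  fix A assume "A \<in> sets (distr M ?N (?X t))"
  then have A [measurable]: "A \<in> sets ?N" by simp
  have m: "(\<integral>\<omega>. indicator A (?X s \<omega>) \<partial>M) = measure (distr M ?N (?X s)) A" if "s \<ge> 1" for s
  proof -
    have "(\<integral>\<omega>. indicator A (?X s \<omega>) \<partial>M) = (\<integral>x. indicator A x \<partial>distr M ?N (?X s) :: real)"
      by (subst integral_distr[OF X[OF that]]) auto
    also have "\<dots> = measure (distr M ?N (?X s)) A" by simp
    finally show ?thesis .
  qed
  have "(\<lambda>n. \<integral>\<omega>. indicator A (?X t \<omega>) * (1::real) \<partial>M) \<longlonglongrightarrow>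
      (\<integral>\<omega>. indicator A (?X 1 \<omega>) \<partial>M) * (\<integral>\<omega>. (1::real) \<partial>M)"
  proof (rule erg[unfolded ergodic_stationary_def, rule_format,
        of k 1 t "indicator A" "\<lambda>_. 1"])
    show "bounded ((indicator A :: _ \<Rightarrow> real) ` space ?N)"
      by (rule boundedI[of _ 1]) (auto simp: indicator_def)
    show "bounded ((\<lambda>_. 1 :: real) ` space (\<Pi>\<^sub>M i\<in>{..<1::nat}. (borel :: real measure)))"
      by (rule boundedI[of _ 1]) auto
  qed (use k t in auto)
  then have "(\<integral>\<omega>. indicator A (?X t \<omega>) \<partial>M) = (\<integral>\<omega>. indicator A (?X 1 \<omega>) \<partial>M :: real)"
    by (simp add: LIMSEQ_const_iff prob_space)
  then have "measure (distr M ?N (?X t)) A = measure (distr M ?N (?X 1)) A"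
    unfolding m[OF t] m[OF order_refl] .
  then show "emeasure (distr M ?N (?X t)) A = emeasure (distr M ?N (?X 1)) A"
    by (simp only: finite_measure.emeasure_eq_measure[OF finite_measure_distr[OF X[OF t]]]
        finite_measure.emeasure_eq_measure[OF finite_measure_distr[OF X[OF order_refl]]])
qed simp

text \<open>Passing through the laws extends stationarity from the bounded test functions of the
  definition to unbounded \<phi>.\<close>

lemma ergodic_stationary_integral:
  fixes \<phi> :: "(nat \<Rightarrow> real) \<Rightarrow> real"
  assumes "prob_space M" and Z: "\<And>i. i \<ge> 1 \<Longrightarrow> Z i \<in> borel_measurable M"
    and "ergodic_stationary M Z" and k: "k \<ge> 1" and t: "t \<ge> 1"
    and \<phi>: "\<phi> \<in> borel_measurable (\<Pi>\<^sub>M i\<in>{..<k}. borel)"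
  shows "integrable M (\<lambda>\<omega>. \<phi> (\<lambda>i\<in>{..<k}. Z (t + i) \<omega>)) \<longleftrightarrow>
      integrable M (\<lambda>\<omega>. \<phi> (\<lambda>i\<in>{..<k}. Z (1 + i) \<omega>))"
    and "(\<integral>\<omega>. \<phi> (\<lambda>i\<in>{..<k}. Z (t + i) \<omega>) \<partial>M) = (\<integral>\<omega>. \<phi> (\<lambda>i\<in>{..<k}. Z (1 + i) \<omega>) \<partial>M)"
proof -
  have X: "(\<lambda>\<omega>. \<lambda>i\<in>{..<k}. Z (s + i) \<omega>) \<in> measurable M (\<Pi>\<^sub>M i\<in>{..<k}. borel)" if "s \<ge> 1" for s
    using that by (intro measurable_restrict Z) auto
  note D = ergodic_stationary_distr[OF assms(1-5)]
  show "integrable M (\<lambda>\<omega>. \<phi> (\<lambda>i\<in>{..<k}. Z (t + i) \<omega>)) \<longleftrightarrow>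
      integrable M (\<lambda>\<omega>. \<phi> (\<lambda>i\<in>{..<k}. Z (1 + i) \<omega>))"
    using integrable_distr_eq[OF X[OF t] \<phi>] integrable_distr_eq[OF X[of 1] \<phi>] by (simp add: D)
  show "(\<integral>\<omega>. \<phi> (\<lambda>i\<in>{..<k}. Z (t + i) \<omega>) \<partial>M) = (\<integral>\<omega>. \<phi> (\<lambda>i\<in>{..<k}. Z (1 + i) \<omega>) \<partial>M)"
    using integral_distr[OF X[OF t] \<phi>] integral_distr[OF X[of 1] \<phi>] by (simp add: D)
qed

section \<open>Garsia's maximal ergodic inequality\<close>

text \<open>The maximum of the sums of the first k terms over 0 \<le> k \<le> N, the empty sum
  included. Recursion on the first term exposes the shifted sequence, which Garsia's argument
  compares with the original.\<close>

primrec max_partial_sum :: "nat \<Rightarrow> (nat \<Rightarrow> real) \<Rightarrow> real" where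
  "max_partial_sum 0 y = 0"
| "max_partial_sum (Suc N) y = max 0 (y 0 + max_partial_sum N (\<lambda>i. y (Suc i)))"

lemma max_partial_sum_nonneg: "0 \<le> max_partial_sum N y"
  by (cases N) auto

lemma max_partial_sum_mono: "max_partial_sum N y \<le> max_partial_sum (Suc N) y"
proof (induction N arbitrary: y)
  case (Suc N)
  from Suc.IH[of "\<lambda>i. y (Suc i)"] show ?case by auto
qed simp

lemma sum_le_max_partial_sum: "k \<le> N \<Longrightarrow> (\<Sum>i<k. y i) \<le> max_partial_sum N y"
proof (induction N arbitrary: k y)
  case (Suc N)
  show ?case
  proof (cases k)
    case (Suc k')
    then show ?thesis
      using Suc.IH[of k' "\<lambda>i. y (Suc i)"] Suc.prems by (simp add: sum.lessThan_Suc_shift del: sum.lessThan_Suc)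
  qed simp
qed simp

lemma max_partial_sum_cong:
  "(\<And>i. i < N \<Longrightarrow> x i = y i) \<Longrightarrow> max_partial_sum N x = max_partial_sum N y"
proof (induction N arbitrary: x y)
  case (Suc N)
  have "max_partial_sum N (\<lambda>i. x (Suc i)) = max_partial_sum N (\<lambda>i. y (Suc i))"
    using Suc.prems by (intro Suc.IH) simp
  then show ?case using Suc.prems[of 0] by simp
qed simp

text \<open>A positive maximum equals y 0 plus the maximum of the shifted sequence over one term
  fewer, and allowing one term more only increases the latter. A zero maximum leaves minus a
  nonnegative number.\<close>

lemma max_partial_sum_garsia:
  "max_partial_sum N y - max_partial_sum N (\<lambda>i. y (Suc i)) \<le> (if 0 < max_partial_sum N y then y 0 else 0)"
proof (cases N)
  case (Suc N')
  then show ?thesis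
    using max_partial_sum_mono[of N' "\<lambda>i. y (Suc i)"] max_partial_sum_nonneg[of N "\<lambda>i. y (Suc i)"]
    by auto
qed simp

lemma borel_measurable_max_partial_sum:
  "(\<And>i. i < N \<Longrightarrow> (\<lambda>x. Y i x) \<in> borel_measurable M) \<Longrightarrow>
    (\<lambda>x. max_partial_sum N (\<lambda>i. Y i x)) \<in> borel_measurable M"
proof (induction N arbitrary: Y)
  case (Suc N)
  have "(\<lambda>x. max_partial_sum N (\<lambda>i. Y (Suc i) x)) \<in> borel_measurable M"
    using Suc.prems by (intro Suc.IH) simp
  then show ?case using Suc.prems[of 0] by simp
qed simp

lemma integrable_max_partial_sum:
  "(\<And>i. i < N \<Longrightarrow> integrable M (\<lambda>x. Y i x)) \<Longrightarrow>
    integrable M (\<lambda>x. max_partial_sum N (\<lambda>i. Y i x))"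
proof (induction N arbitrary: Y)
  case (Suc N)
  have "integrable M (\<lambda>x. max_partial_sum N (\<lambda>i. Y (Suc i) x))"
    using Suc.prems by (intro Suc.IH) simp
  then show ?case using Suc.prems[of 0] by simp
qed simp

text \<open>Integrate Garsia's bound for the terms g(Z_(i+1)) - c. By stationarity the two maxima
  have equal means, so c P(F N > 0) is at most the mean of g(Z_1). The events F N > 0 increase with
  N, and their union contains the event in question.\<close>

lemma maximal_inequality:
  fixes g :: "real \<Rightarrow> real"
  assumes "prob_space M" and Z: "\<And>i. i \<ge> 1 \<Longrightarrow> Z i \<in> borel_measurable M"
    and erg: "ergodic_stationary M Z"
    and [measurable]: "g \<in> borel_measurable borel" and g0: "\<And>x. 0 \<le> g x"
    and int: "integrable M (\<lambda>\<omega>. g (Z 1 \<omega>))" and c: "c > 0"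
  shows "measure M {\<omega> \<in> space M. \<exists>n\<ge>1. c * n < (\<Sum>i=1..n. g (Z i \<omega>))} \<le> (\<integral>\<omega>. g (Z 1 \<omega>) \<partial>M) / c"
proof -
  interpret prob_space M by fact
  note stat = ergodic_stationary_integral[OF assms(1-3)]
  have meas [measurable]: "(\<lambda>\<omega>. g (Z (Suc i) \<omega>)) \<in> borel_measurable M" for i
    using Z[of "Suc i"] by simp
  have intg: "integrable M (\<lambda>\<omega>. g (Z (Suc i) \<omega>))" for i
    using stat(1)[of 1 "Suc i" "\<lambda>x. g (x 0)"] int by simp
  define Y where "Y i \<omega> = g (Z (Suc i) \<omega>) - c" for i \<omega>
  have intY: "integrable M (\<lambda>\<omega>. Y i \<omega>)" for i unfolding Y_def using intg by simp
  have [measurable]: "Y i \<in> borel_measurable M" for i unfolding Y_def by measurable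
  define F where "F N \<omega> = max_partial_sum N (\<lambda>i. Y i \<omega>)" for N \<omega>
  define F' where "F' N \<omega> = max_partial_sum N (\<lambda>i. Y (Suc i) \<omega>)" for N \<omega>
  have intF: "integrable M (F N)" "integrable M (F' N)" for N
    unfolding F_def F'_def by (intro integrable_max_partial_sum intY)+
  have [measurable]: "F N \<in> borel_measurable M" for N using intF by blast
  \<comment> \<open>\<open>F' N\<close> is the functional \<phi> of Z_2, ..., Z_(N+1), and
    \<open>F N\<close> the same functional of Z_1, ..., Z_N. Stationarity is available for blocks of
    length at least 1, so N = 0 is separate.\<close>
  have shift: "(\<integral>\<omega>. F' N \<omega> \<partial>M) = (\<integral>\<omega>. F N \<omega> \<partial>M)" for N
  proof (cases "N = 0")
    case False
    define \<phi> where "\<phi> x = max_partial_sum N (\<lambda>i. g (x i) - c)" for x :: "nat \<Rightarrow> real"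
    have \<phi>: "\<phi> \<in> borel_measurable (\<Pi>\<^sub>M i\<in>{..<N}. borel)"
      unfolding \<phi>_def by (intro borel_measurable_max_partial_sum) measurable
    have "\<phi> (\<lambda>i\<in>{..<N}. Z (2 + i) \<omega>) = F' N \<omega>" "\<phi> (\<lambda>i\<in>{..<N}. Z (1 + i) \<omega>) = F N \<omega>" for \<omega>
      unfolding \<phi>_def F_def F'_def Y_def by (auto intro!: max_partial_sum_cong)
    then show ?thesis using stat(2)[of N 2 \<phi>] \<phi> False by simp
  qed (simp add: F_def F'_def)
  have PF: "c * measure M {\<omega> \<in> space M. 0 < F N \<omega>} \<le> (\<integral>\<omega>. g (Z 1 \<omega>) \<partial>M)" for N
  proof -
    let ?A = "{\<omega> \<in> space M. 0 < F N \<omega>}"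
    have "0 = (\<integral>\<omega>. F N \<omega> - F' N \<omega> \<partial>M)" using intF shift by simp
    \<comment> \<open>Off \<open>?A\<close> Garsia's bound is 0, which is at most g(Z_1) by
      nonnegativity.\<close>
    also have "\<dots> \<le> (\<integral>\<omega>. g (Z 1 \<omega>) - c * indicator ?A \<omega> \<partial>M)"
    proof (rule integral_mono)
      fix \<omega> assume "\<omega> \<in> space M"
      then show "F N \<omega> - F' N \<omega> \<le> g (Z 1 \<omega>) - c * indicator ?A \<omega>"
        using max_partial_sum_garsia[of N "\<lambda>i. Y i \<omega>"] g0[of "Z 1 \<omega>"]
        by (auto simp: F_def F'_def Y_def indicator_def split: if_splits)
    qed (use intF int in \<open>auto intro!: Bochner_Integration.integrable_diff integrable_mult_right integrable_real_indicator simp: less_top[symmetric]\<close>)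
    also have "\<dots> = (\<integral>\<omega>. g (Z 1 \<omega>) \<partial>M) - c * measure M ?A"
      using int by (subst Bochner_Integration.integral_diff) (auto intro!: integrable_mult_right integrable_real_indicator simp: less_top[symmetric])
    finally show ?thesis by simp
  qed
  have lim: "(\<lambda>N. measure M {\<omega> \<in> space M. 0 < F N \<omega>}) \<longlonglongrightarrow> measure M (\<Union>N. {\<omega> \<in> space M. 0 < F N \<omega>})"
  proof (rule finite_Lim_measure_incseq)
    show "incseq (\<lambda>N. {\<omega> \<in> space M. 0 < F N \<omega>})"
      using max_partial_sum_mono by (intro incseq_SucI) (fastforce simp: F_def simp del: max_partial_sum.simps intro: less_le_trans)
  qed auto
  have "measure M {\<omega> \<in> space M. \<exists>n\<ge>1. c * n < (\<Sum>i=1..n. g (Z i \<omega>))} \<le>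
      measure M (\<Union>N. {\<omega> \<in> space M. 0 < F N \<omega>})"
  proof (rule finite_measure_mono)
    show "{\<omega> \<in> space M. \<exists>n\<ge>1. c * n < (\<Sum>i=1..n. g (Z i \<omega>))} \<subseteq> (\<Union>N. {\<omega> \<in> space M. 0 < F N \<omega>})"
    proof safe
      fix \<omega> and n :: nat assume "\<omega> \<in> space M" and n: "c * n < (\<Sum>i=1..n. g (Z i \<omega>))"
      have "(\<Sum>i=1..n. g (Z i \<omega>)) = (\<Sum>i<n. g (Z (Suc i) \<omega>))"
        by (simp add: sum.atLeast1_atMost_eq)
      then have "0 < (\<Sum>i<n. Y i \<omega>)" using n by (simp add: Y_def sum_subtractf mult.commute)
      also have "\<dots> \<le> F n \<omega>" unfolding F_def by (rule sum_le_max_partial_sum) simp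
      finally show "\<omega> \<in> (\<Union>N. {\<omega> \<in> space M. 0 < F N \<omega>})" using \<open>\<omega> \<in> space M\<close> by blast
    qed
  qed measurable
  also have "\<dots> \<le> (\<integral>\<omega>. g (Z 1 \<omega>) \<partial>M) / c"
    by (rule LIMSEQ_le_const2[OF lim]) (use PF c in \<open>auto simp: field_simps\<close>)
  finally show ?thesis .
qed

text \<open>Unbounded averages exceed every level k + 1, an event of probability at most a constant
  over k + 1 by the maximal inequality.\<close>

lemma AE_averages_bounded:
  fixes g :: "real \<Rightarrow> real"
  assumes "prob_space M" and Z: "\<And>i. i \<ge> 1 \<Longrightarrow> Z i \<in> borel_measurable M"
    and erg: "ergodic_stationary M Z"
    and g [measurable]: "g \<in> borel_measurable borel" and g0: "\<And>x. 0 \<le> g x"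
    and int: "integrable M (\<lambda>\<omega>. g (Z 1 \<omega>))"
  shows "AE \<omega> in M. \<exists>c::real. \<forall>n\<ge>1. (\<Sum>i=1..n. g (Z i \<omega>)) \<le> c * n"
proof -
  interpret prob_space M by fact
  define B where "B c = {\<omega> \<in> space M. \<exists>n\<ge>1. c * n < (\<Sum>i=1..n. g (Z i \<omega>))}" for c :: real
  have gm: "(\<lambda>\<omega>. g (Z i \<omega>)) \<in> borel_measurable M" if "i \<ge> 1" for i using Z[OF that] by simp
  have sm [measurable]: "(\<lambda>\<omega>. \<Sum>i=1..n. g (Z i \<omega>)) \<in> borel_measurable M" for n :: nat
    by (intro borel_measurable_sum gm) auto
  have B [measurable]: "B c \<in> sets M" for c unfolding B_def by measurable
  let ?E = "\<integral>\<omega>. g (Z 1 \<omega>) \<partial>M"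
  let ?I = "\<Inter>k. B (real (Suc k))"
  have "measure M ?I \<le> ?E / real (Suc k)" for k
  proof -
    have "measure M ?I \<le> measure M (B (real (Suc k)))" by (rule finite_measure_mono) auto
    also have "\<dots> \<le> ?E / real (Suc k)"
      unfolding B_def by (rule maximal_inequality[OF assms]) auto
    finally show ?thesis .
  qed
  moreover have "(\<lambda>k. ?E / real (Suc k)) \<longlonglongrightarrow> 0"
    by (rule LIMSEQ_Suc) (rule lim_const_over_n)
  ultimately have "measure M ?I \<le> 0" by (intro LIMSEQ_le_const) auto
  then have "?I \<in> null_sets M" by (intro null_setsI) (auto simp: emeasure_eq_measure measure_le_0_iff)
  then have "AE \<omega> in M. \<omega> \<notin> ?I" by (rule AE_not_in)
  with AE_space show ?thesis
  proof eventually_elim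
    case (elim \<omega>)
    then obtain k where "\<omega> \<notin> B (real (Suc k))" by blast
    then show ?case using elim(1) by (intro exI[of _ "real (Suc k)"]) (auto simp: B_def not_less)
  qed
qed

section \<open>Borel-Cantelli for the squares\<close>

text \<open>Pointwise, the number of integers k + 1 below X is at most the floor of X; taking
  expectations bounds all partial sums by the mean of X.\<close>

lemma summable_prob_gt:
  assumes "prob_space M" and int: "integrable M X" and X0: "\<And>\<omega>. 0 \<le> X \<omega>"
  shows "summable (\<lambda>n. measure M {\<omega> \<in> space M. real (Suc n) < X \<omega>})"
proof (rule summableI_nonneg_bounded)
  interpret prob_space M by fact
  have [measurable]: "X \<in> borel_measurable M" using int by simp
  fix n
  define A where "A k = {\<omega> \<in> space M. real (Suc k) < X \<omega>}" for k
  have [measurable]: "A k \<in> sets M" for k unfolding A_def by measurable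
  have intA: "integrable M (indicat_real (A k))" for k
    by (intro integrable_real_indicator) (auto simp: less_top[symmetric])
  have "(\<Sum>k<n. measure M (A k)) = (\<integral>\<omega>. (\<Sum>k<n. indicator (A k) \<omega>) \<partial>M)"
    by (subst Bochner_Integration.integral_sum) (auto simp: intA)
  also have "\<dots> \<le> (\<integral>\<omega>. X \<omega> \<partial>M)"
  proof (rule integral_mono[OF _ int])
    fix \<omega> assume "\<omega> \<in> space M"
    then have "(\<Sum>k<n. indicat_real (A k) \<omega>) = real (card {k. k < n \<and> real (Suc k) < X \<omega>})"
      by (simp add: A_def indicator_def sum.If_cases Int_def)
    also have "\<dots> \<le> real (card {..<nat \<lfloor>X \<omega>\<rfloor>})"
    proof (intro of_nat_mono card_mono)
      show "{k. k < n \<and> real (Suc k) < X \<omega>} \<subseteq> {..<nat \<lfloor>X \<omega>\<rfloor>}"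
      proof (rule subsetI)
        fix k assume "k \<in> {k. k < n \<and> real (Suc k) < X \<omega>}"
        then have "int (Suc k) \<le> \<lfloor>X \<omega>\<rfloor>" by (simp add: le_floor_iff)
        then show "k \<in> {..<nat \<lfloor>X \<omega>\<rfloor>}" by simp
      qed
    qed simp
    also have "\<dots> \<le> X \<omega>" using X0[of \<omega>] by simp
    finally show "(\<Sum>k<n. indicat_real (A k) \<omega>) \<le> X \<omega>" .
  qed (simp add: intA)
  finally show "(\<Sum>k<n. measure M {\<omega> \<in> space M. real (Suc k) < X \<omega>}) \<le> (\<integral>\<omega>. X \<omega> \<partial>M)"
    by (simp add: A_def)
qed simp

text \<open>By stationarity the event that the square of Z_n exceeds e n has the probability that
  Z_1^2 / e exceeds n. These probabilities are summable, so Borel-Cantelli applies for each fixed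
  e.\<close>

lemma AE_square_negligible:
  assumes "prob_space M" and Z: "\<And>i. i \<ge> 1 \<Longrightarrow> Z i \<in> borel_measurable M"
    and erg: "ergodic_stationary M Z" and int: "integrable M (\<lambda>\<omega>. (Z 1 \<omega>)\<^sup>2)"
  shows "AE \<omega> in M. \<forall>e>0. \<forall>\<^sub>F n in sequentially. (Z n \<omega>)\<^sup>2 \<le> e * real n"
proof -
  interpret prob_space M by fact
  note stat = ergodic_stationary_integral[OF assms(1-3)]
  have [measurable]: "Z (Suc i) \<in> borel_measurable M" for i by (rule Z) simp
  have 1: "AE \<omega> in M. \<forall>\<^sub>F n in sequentially. (Z (Suc n) \<omega>)\<^sup>2 \<le> e * Suc n" if e: "e > 0" for e :: real
  proof -
    define A where "A n = {\<omega> \<in> space M. e * Suc n < (Z (Suc n) \<omega>)\<^sup>2}" for n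
    have [measurable]: "A n \<in> sets M" for n unfolding A_def by measurable
    have mA: "measure M (A n) = measure M {\<omega> \<in> space M. real (Suc n) < (Z 1 \<omega>)\<^sup>2 / e}" for n
    proof -
      let ?\<phi> = "\<lambda>x :: nat \<Rightarrow> real. indicator {x. e * Suc n < x\<^sup>2} (x 0) :: real"
      have *: "measure M {\<omega> \<in> space M. e * Suc n < (Z (Suc i) \<omega>)\<^sup>2} =
          (\<integral>\<omega>. ?\<phi> (\<lambda>j\<in>{..<1}. Z (Suc i + j) \<omega>) \<partial>M)" for i
      proof -
        have "{\<omega> \<in> space M. e * Suc n < (Z (Suc i) \<omega>)\<^sup>2} \<in> sets M" by measurable
        then have "measure M {\<omega> \<in> space M. e * Suc n < (Z (Suc i) \<omega>)\<^sup>2} =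
            (\<integral>\<omega>. indicator {\<omega> \<in> space M. e * Suc n < (Z (Suc i) \<omega>)\<^sup>2} \<omega> \<partial>M)"
          by (simp only: Bochner_Integration.integral_indicator sets.Int_space_eq2)
        also have "\<dots> = (\<integral>\<omega>. ?\<phi> (\<lambda>j\<in>{..<1}. Z (Suc i + j) \<omega>) \<partial>M)"
          by (intro Bochner_Integration.integral_cong) (auto simp: indicator_def)
        finally show ?thesis .
      qed
      have "measure M (A n) = measure M {\<omega> \<in> space M. e * Suc n < (Z 1 \<omega>)\<^sup>2}"
        using stat(2)[of 1 "Suc n" ?\<phi>] *[of n] *[of 0] by (simp add: A_def)
      also have "{\<omega> \<in> space M. e * Suc n < (Z 1 \<omega>)\<^sup>2} = {\<omega> \<in> space M. real (Suc n) < (Z 1 \<omega>)\<^sup>2 / e}"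
        using e by (simp add: pos_less_divide_eq mult.commute)
      finally show ?thesis .
    qed
    have "AE \<omega> in M. \<forall>\<^sub>F n in sequentially. \<omega> \<in> space M - A n"
    proof (rule borel_cantelli_AE1)
      show "summable (\<lambda>n. measure M (A n))"
        unfolding mA using int e by (intro summable_prob_gt prob_space_axioms) auto
    qed (auto simp: less_top[symmetric])
    then show ?thesis
      by (rule eventually_mono) (auto simp: A_def not_less elim!: eventually_mono)
  qed
  \<comment> \<open>Only countably many null sets may be united, so e runs through the reciprocals
    1/(k + 1).\<close>
  have "AE \<omega> in M. \<forall>k. \<forall>\<^sub>F n in sequentially. (Z (Suc n) \<omega>)\<^sup>2 \<le> 1 / real (Suc k) * Suc n"
    unfolding AE_all_countable by (intro allI 1) simp
  then show ?thesis
  proof eventually_elim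
    case (elim \<omega>)
    show ?case
    proof (intro allI impI)
      fix e :: real assume "e > 0"
      then obtain k where k: "1 / real (Suc k) < e" by (metis nat_approx_posE)
      have "\<forall>\<^sub>F n in sequentially. (Z (Suc n) \<omega>)\<^sup>2 \<le> e * real (Suc n)"
        using elim[THEN spec, of k]
      proof eventually_elim
        case (elim n)
        also have "1 / real (Suc k) * real (Suc n) \<le> e * real (Suc n)"
          using k by (intro mult_right_mono) auto
        finally show ?case .
      qed
      then show "\<forall>\<^sub>F n in sequentially. (Z n \<omega>)\<^sup>2 \<le> e * real n"
        by (subst eventually_sequentially_Suc[symmetric])
    qed
  qed
qed

subsection \<open>The expansion along a stationary sequence\<close>

text \<open>Beyond some N each |x i| is at most (e/2) sqrt i, hence at most (e/2) sqrt n. The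
  entries before N are bounded by a constant, which sqrt n eventually dominates.\<close>

lemma running_max_over_sqrt_tendsto_0:
  fixes x :: "nat \<Rightarrow> real"
  assumes x: "\<And>e. e > 0 \<Longrightarrow> \<forall>\<^sub>F n in sequentially. (x n)\<^sup>2 \<le> e * real n"
  shows "(\<lambda>n. Max ((\<lambda>i. \<bar>x i\<bar>) ` {1..n}) / sqrt (real n)) \<longlonglongrightarrow> 0"
proof (rule tendstoI)
  fix e :: real assume e: "e > 0"
  from x[of "(e/2)\<^sup>2"] e obtain N where N: "\<And>n. n \<ge> N \<Longrightarrow> (x n)\<^sup>2 \<le> (e/2)\<^sup>2 * real n"
    by (auto simp: eventually_sequentially)
  have xN: "\<bar>x i\<bar> \<le> e/2 * sqrt (real i)" if "i \<ge> N" for i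
    using real_sqrt_le_mono[OF N[OF that]] e by (simp add: real_sqrt_mult)
  define K where "K = (\<Sum>i<N. \<bar>x i\<bar>)"
  have "filterlim (\<lambda>n. sqrt (real n)) at_top sequentially"
    by (rule filterlim_compose[OF sqrt_at_top filterlim_real_sequentially])
  then have "\<forall>\<^sub>F n in sequentially. 2 * K / e \<le> sqrt (real n)"
    by (simp add: filterlim_at_top)
  with eventually_ge_at_top[of 1]
  show "\<forall>\<^sub>F n in sequentially. dist (Max ((\<lambda>i. \<bar>x i\<bar>) ` {1..n}) / sqrt (real n)) 0 < e"
  proof eventually_elim
    case (elim n)
    have ne: "(\<lambda>i. \<bar>x i\<bar>) ` {1..n} \<noteq> {}" using elim by simp
    have "\<bar>x i\<bar> \<le> e/2 * sqrt n" if "i \<in> {1..n}" for i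
    proof (cases "i \<ge> N")
      case True
      have "\<bar>x i\<bar> \<le> e/2 * sqrt i" by (rule xN[OF True])
      also have "\<dots> \<le> e/2 * sqrt n" using that e by (intro mult_left_mono) auto
      finally show ?thesis .
    next
      case False
      then have "\<bar>x i\<bar> \<le> K" unfolding K_def by (intro member_le_sum) auto
      also have "\<dots> \<le> e/2 * sqrt n" using elim e by (simp add: field_simps)
      finally show ?thesis .
    qed
    then have "Max ((\<lambda>i. \<bar>x i\<bar>) ` {1..n}) \<le> e/2 * sqrt n" using ne by (subst Max_le_iff) auto
    moreover have "0 \<le> Max ((\<lambda>i. \<bar>x i\<bar>) ` {1..n})" using ne elim by (subst Max_ge_iff) auto
    moreover have "e/2 * sqrt n < e * sqrt n" using e elim by simp
    ultimately have "\<bar>Max ((\<lambda>i. \<bar>x i\<bar>) ` {1..n})\<bar> < e * sqrt n" by linarith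
    then show ?case using elim(1) by (simp only: dist_0_norm dist_commute[of _ 0] real_norm_def)
        (simp add: pos_divide_less_eq del: Max_less_iff)
  qed
qed

theorem lemma1:
  fixes M :: "'a measure" and Z :: "nat \<Rightarrow> 'a \<Rightarrow> real"
    and f :: "real \<Rightarrow> ereal" and \<rho> :: real
  assumes "prob_space M"
    and "\<And>i. i \<ge> 1 \<Longrightarrow> Z i \<in> borel_measurable M"
    and "ergodic_stationary M Z"
    and "integrable M (\<lambda>\<omega>. (Z 1 \<omega>)\<^sup>2)"
    and "smooth_divergence_function f"
    and "\<rho> > 0"
  shows "\<exists>\<epsilon> :: nat \<Rightarrow> 'a \<Rightarrow> real.
    (\<forall>n. \<epsilon> n \<in> borel_measurable M) \<and>
    (\<forall>n\<ge>1. \<forall>\<omega>\<in>space M.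
       let z = (\<lambda>i. Z i \<omega>) in
       \<bar>(SUP P\<in>f_divergence_ball f (\<rho> / real n) (empirical n z). mean P)
          - mean (empirical n z) - sqrt (\<rho> / real n * sample_variance n z)\<bar>
         \<le> \<epsilon> n \<omega> / sqrt (real n)) \<and>
    (AE \<omega> in M. (\<lambda>n. \<epsilon> n \<omega>) \<longlonglongrightarrow> 0)"
proof -
  note Z = assms(2) and \<rho> = assms(6)
  let ?D = "\<lambda>n z. \<bar>(SUP P\<in>f_divergence_ball f (\<rho> / real n) (empirical n z). mean P)
      - mean (empirical n z) - sqrt (\<rho> / real n * sample_variance n z)\<bar>"
  have "\<exists>C\<ge>0. \<forall>n\<ge>1. \<forall>z m. (\<forall>i\<in>{1..n}. \<bar>z i\<bar> \<le> m) \<longrightarrow>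
      ?D n z \<le> (sqrt \<rho> * (1 / real (Suc j)) * sqrt (sample_variance n z) + C * (m / sqrt (real n))) / sqrt (real n)" for j
    using robust_mean_expansion[OF assms(5,6), of "1 + 1 / real (Suc j)"] by simp
  \<comment> \<open>The constants belong to \<theta> = 1 + 1/(j + 1). No bound uniform in j is
    claimed, so j must be fixed before n tends to infinity.\<close>
  then obtain C where C0: "\<And>j. 0 \<le> C j" and C: "\<And>j n z m. n \<ge> 1 \<Longrightarrow> (\<And>i. i \<in> {1..n} \<Longrightarrow> \<bar>z i\<bar> \<le> m) \<Longrightarrow>
      ?D n z \<le> (sqrt \<rho> * (1 / real (Suc j)) * sqrt (sample_variance n z) + C j * (m / sqrt (real n))) / sqrt (real n)"
    by metis
  \<comment> \<open>The root mean square dominates the sample standard deviation and involves only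
    averages of squares, to which \<open>AE_averages_bounded\<close> applies.\<close>
  define R where "R n \<omega> = sqrt ((\<Sum>i=1..n. (Z i \<omega>)\<^sup>2) / real n)" for n \<omega>
  define m where "m n \<omega> = Max ((\<lambda>i. \<bar>Z i \<omega>\<bar>) ` {1..n}) / sqrt (real n)" for n \<omega>
  define T where "T j n \<omega> = sqrt \<rho> * (1 / real (Suc j)) * R n \<omega> + C j * m n \<omega>" for j n \<omega>
  define \<epsilon> where "\<epsilon> n \<omega> = (INF j. T j n \<omega>)" for n \<omega>
  have [measurable]: "R n \<in> borel_measurable M" for n
  proof -
    have "(\<lambda>\<omega>. \<Sum>i=1..n. (Z i \<omega>)\<^sup>2) \<in> borel_measurable M"
      by (intro borel_measurable_sum borel_measurable_power Z) auto
    then show ?thesis unfolding R_def by simp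
  qed
  have [measurable]: "m n \<in> borel_measurable M" for n
  proof -
    have "(\<lambda>\<omega>. Max ((\<lambda>i. \<bar>Z i \<omega>\<bar>) ` {1..n})) \<in> borel_measurable M"
      by (intro borel_measurable_Max borel_measurable_abs Z) auto
    then show ?thesis unfolding m_def by simp
  qed
  have "T j n \<in> borel_measurable M" for j n unfolding T_def by measurable
  then have meas: "\<epsilon> n \<in> borel_measurable M" for n
    unfolding \<epsilon>_def by (intro borel_measurable_cINF_real) auto
  have DT: "?D n (\<lambda>i. Z i \<omega>) * sqrt (real n) \<le> T j n \<omega>" if n: "n \<ge> 1" for j n \<omega>
  proof -
    have "sample_variance n (\<lambda>i. Z i \<omega>) \<le> (\<Sum>i=1..n. (Z i \<omega>)\<^sup>2) / real n"
      by (simp add: sample_variance_def integral_empirical)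
    then have "sqrt (sample_variance n (\<lambda>i. Z i \<omega>)) \<le> R n \<omega>" unfolding R_def by simp
    then have "sqrt \<rho> * (1 / real (Suc j)) * sqrt (sample_variance n (\<lambda>i. Z i \<omega>)) + C j * m n \<omega> \<le> T j n \<omega>"
      unfolding T_def using \<rho> by (intro add_right_mono mult_left_mono) auto
    moreover have "?D n (\<lambda>i. Z i \<omega>) \<le>
        (sqrt \<rho> * (1 / real (Suc j)) * sqrt (sample_variance n (\<lambda>i. Z i \<omega>)) + C j * m n \<omega>) / sqrt (real n)"
      unfolding m_def by (rule C[OF n]) simp
    ultimately show ?thesis
      using n by (simp add: pos_le_divide_eq del: of_nat_Suc)
  qed
  have D\<epsilon>: "?D n (\<lambda>i. Z i \<omega>) \<le> \<epsilon> n \<omega> / sqrt (real n)" if n: "n \<ge> 1" for n \<omega>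
  proof -
    have "?D n (\<lambda>i. Z i \<omega>) * sqrt (real n) \<le> \<epsilon> n \<omega>"
      unfolding \<epsilon>_def by (rule cINF_greatest) (use DT[OF n] in auto)
    then show ?thesis using n by (simp add: pos_le_divide_eq)
  qed
  \<comment> \<open>The scaled deviation is a lower bound for all T j n, so the real infimum is a
    genuine one.\<close>
  have \<epsilon>T: "\<epsilon> n \<omega> \<le> T j n \<omega>" if "n \<ge> 1" for j n \<omega>
  proof -
    have "bdd_below (range (\<lambda>j. T j n \<omega>))"
      using DT[OF that] by (intro bdd_belowI[of _ "?D n (\<lambda>i. Z i \<omega>) * sqrt (real n)"]) auto
    then show ?thesis unfolding \<epsilon>_def by (intro cINF_lower) auto
  qed
  have \<epsilon>0: "0 \<le> \<epsilon> n \<omega>" if "n \<ge> 1" for n \<omega>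
  proof -
    have "0 \<le> \<epsilon> n \<omega> / sqrt (real n)" by (rule order_trans[OF _ D\<epsilon>[OF that]]) simp
    then show ?thesis using that by (simp add: zero_le_divide_iff)
  qed
  have "AE \<omega> in M. \<exists>c::real. \<forall>n\<ge>1. (\<Sum>i=1..n. (Z i \<omega>)\<^sup>2) \<le> c * n"
    using assms by (intro AE_averages_bounded) auto
  moreover have "AE \<omega> in M. \<forall>e>0. \<forall>\<^sub>F n in sequentially. (Z n \<omega>)\<^sup>2 \<le> e * real n"
    using assms by (intro AE_square_negligible)
  ultimately have "AE \<omega> in M. (\<lambda>n. \<epsilon> n \<omega>) \<longlonglongrightarrow> 0"
  proof eventually_elim
    case (elim \<omega>)
    then obtain c :: real where c: "\<And>n. n \<ge> 1 \<Longrightarrow> (\<Sum>i=1..n. (Z i \<omega>)\<^sup>2) \<le> c * n" by blast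
    have m0: "(\<lambda>n. m n \<omega>) \<longlonglongrightarrow> 0"
      unfolding m_def using elim(2) by (intro running_max_over_sqrt_tendsto_0) blast
    have R: "R n \<omega> \<le> sqrt c" if "n \<ge> 1" for n
      using c[OF that] that unfolding R_def by (simp add: pos_divide_le_eq)
    show ?case
    proof (rule tendstoI)
      fix e :: real assume e: "e > 0"
      \<comment> \<open>First j makes the variance term small uniformly in n; then n makes the
        maximum term small for this j.\<close>
      have "(\<lambda>j. sqrt \<rho> * sqrt c / real (Suc j)) \<longlonglongrightarrow> 0"
        by (rule LIMSEQ_Suc) (rule lim_const_over_n)
      then have "\<forall>\<^sub>F j in sequentially. sqrt \<rho> * sqrt c / real (Suc j) < e / 2"
        using e by (intro order_tendstoD(2)) auto
      then obtain j where j: "sqrt \<rho> * sqrt c / real (Suc j) < e / 2"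
        by (auto simp: eventually_sequentially)
      have "(\<lambda>n. C j * m n \<omega>) \<longlonglongrightarrow> 0" using m0 by (rule tendsto_mult_right_zero)
      then have "\<forall>\<^sub>F n in sequentially. C j * m n \<omega> < e / 2"
        using e by (intro order_tendstoD(2)) auto
      with eventually_ge_at_top[of 1] show "\<forall>\<^sub>F n in sequentially. dist (\<epsilon> n \<omega>) 0 < e"
      proof eventually_elim
        case (elim n)
        have "\<epsilon> n \<omega> \<le> T j n \<omega>" using elim by (intro \<epsilon>T)
        also have "\<dots> \<le> sqrt \<rho> * (1 / real (Suc j)) * sqrt c + C j * m n \<omega>"
          unfolding T_def using R[OF elim(1)] \<rho> by (intro add_right_mono mult_left_mono) auto
        also have "\<dots> = sqrt \<rho> * sqrt c / real (Suc j) + C j * m n \<omega>" by simp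
        also have "\<dots> < e" using j elim by linarith
        finally show ?case using \<epsilon>0[OF elim(1)] by simp
      qed
    qed
  qed
  then show ?thesis
    using meas D\<epsilon> unfolding Let_def by blast
qed

end
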